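(* Let $(X,\mathcal{A},d)$ be a complete $C^*$-algebra-valued metric space. Suppose that the mappings $F\colon X\times X\rightarrow X$ and $g\colon X\rightarrow X$ satisfy $$d(F(x,y),F(u,v))\preceq a\,d(F(x,y),gu)+b\,d(F(u,v),gx)\quad\text{for any } x,y,u,v\in X,$$ where $a,b\in\mathcal{A}_{+}'$ with $\|a\|+\|b\|<1$. If $F(X\times X)\subseteq g(X)$ and $g(X)$ is complete in $X$, then $F$ and $g$ have a coupled coincidence point. Moreover, if $F$ and $g$ are w-compatible, then they have a unique common coupled fixed point in $X$.
   Context: $\mathcal{A}$ is a unital (complex) $C^*$-algebra with zero element $0_{\mathcal A}$ and unit $1_{\mathcal A}$. An element $a\in\mathcal A$ is positive, written $0_{\mathcal A}\preceq a$, if $a$ is hermitian and its spectrum is contained in $[0,+\infty)$; for hermitian $a,b$, $a\preceq b$ means $0_{\mathcal A}\preceq b-a$. $\mathcal A_+$ is the set of positive elements, $\mathcal A'=\{a\in\mathcal A: ab=ba\ \forall b\in\mathcal A\}$, and $\mathcal A_+'=\mathcal A_+\cap\mathcal A'$. A $C^*$-algebra-valued metric space $(X,\mathcal A,d)$ consists of a nonempty set $X$ and a map $d\colon X\times X\to\mathcal A$ such that for all $x,y,z\in X$: (1) $0_{\mathcal A}\preceq d(x,y)$; (2) $d(x,y)=0_{\mathcal A}$ iff $x=y$; (3) $d(x,y)=d(y,x)$; (4) $d(x,y)\preceq d(x,z)+d(z,y)$. A sequence $\{x_n\}$ converges to $x$ if $\|d(x_n,x)\|\to 0$; it is Cauchy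 if $\|d(x_{n+p},x_n)\|\to 0$ as $n\to\infty$, uniformly in $p\in\mathbb N$. The space is complete if every Cauchy sequence in $X$ converges in $X$; a subset $g(X)$ is complete if every Cauchy sequence in $g(X)$ converges to a point of $g(X)$. We write $gx=g(x)$. For $F\colon X\times X\to X$ and $g\colon X\to X$, a pair $(x,y)\in X\times X$ is a coupled coincidence point of $F$ and $g$ if $F(x,y)=gx$ and $F(y,x)=gy$; it is a common coupled fixed point of $F$ and $g$ if $F(x,y)=gx=x$ and $F(y,x)=gy=y$. $F$ and $g$ are w-compatible if $g(F(x,y))=F(gx,gy)$ whenever $gx=F(x,y)$ and $gy=F(y,x)$. *)

theory Defs
  imports "HOL-Analysis.Analysis"
begin

text \<open>
  Unital complex C*-algebras as a type class. The class \<^class>\<open>real_normed_algebra_1\<close> supplies the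
  ring with unit, the submultiplicative norm and the convention \<open>norm 1 = 1\<close> (so \<open>1 \<noteq> 0\<close>);
  \<^class>\<open>banach\<close> supplies completeness. The complex scalar multiplication extends the real one.
\<close>

class cstar_algebra = real_normed_algebra_1 + banach +
  fixes scaleC :: "complex \<Rightarrow> 'a \<Rightarrow> 'a"
    and adj :: "'a \<Rightarrow> 'a"
  assumes scaleC_add_right: "scaleC c (x + y) = scaleC c x + scaleC c y"
    and scaleC_add_left: "scaleC (c + c') x = scaleC c x + scaleC c' x"
    and scaleC_scaleC: "scaleC c (scaleC c' x) = scaleC (c * c') x"
    and scaleR_scaleC: "scaleR r x = scaleC (complex_of_real r) x"
    and mult_scaleC_left: "scaleC c x * y = scaleC c (x * y)"
    and mult_scaleC_right: "x * scaleC c y = scaleC c (x * y)"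
    and norm_scaleC: "norm (scaleC c x) = cmod c * norm x"
    and adj_adj: "adj (adj x) = x"
    and adj_add: "adj (x + y) = adj x + adj y"
    and adj_scaleC: "adj (scaleC c x) = scaleC (cnj c) (adj x)"
    and adj_mult: "adj (x * y) = adj y * adj x"
    and cstar_identity: "norm (adj x * x) = (norm x)\<^sup>2"

definition hermitian :: "'a::cstar_algebra \<Rightarrow> bool" where
  "hermitian a \<longleftrightarrow> adj a = a"

definition spectrum :: "'a::cstar_algebra \<Rightarrow> complex set" where
  "spectrum a = {z. \<not> (\<exists>b. (a - scaleC z 1) * b = 1 \<and> b * (a - scaleC z 1) = 1)}"

definition positive :: "'a::cstar_algebra \<Rightarrow> bool" where
  "positive a \<longleftrightarrow> hermitian a \<and> spectrum a \<subseteq> complex_of_real ` {0..}"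

definition cstar_le :: "'a::cstar_algebra \<Rightarrow> 'a \<Rightarrow> bool" (infix "\<preceq>" 50) where
  "a \<preceq> b \<longleftrightarrow> hermitian a \<and> hermitian b \<and> positive (b - a)"

definition commutant :: "'a::cstar_algebra set" where
  "commutant = {a. \<forall>b. a * b = b * a}"

definition positive_commutant :: "'a::cstar_algebra set" where
  "positive_commutant = {a. positive a} \<inter> commutant"

locale cstar_metric_space =
  fixes X :: "'x set" and d :: "'x \<Rightarrow> 'x \<Rightarrow> 'a::cstar_algebra"
  assumes nonempty: "X \<noteq> {}"
    and dist_pos: "\<lbrakk>x \<in> X; y \<in> X\<rbrakk> \<Longrightarrow> 0 \<preceq> d x y"
    and dist_eq_0_iff: "\<lbrakk>x \<in> X; y \<in> X\<rbrakk> \<Longrightarrow> d x y = 0 \<longleftrightarrow> x = y"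
    and dist_sym: "\<lbrakk>x \<in> X; y \<in> X\<rbrakk> \<Longrightarrow> d x y = d y x"
    and dist_triangle: "\<lbrakk>x \<in> X; y \<in> X; z \<in> X\<rbrakk> \<Longrightarrow> d x y \<preceq> d x z + d z y"

definition cstar_converges :: "('x \<Rightarrow> 'x \<Rightarrow> 'a::cstar_algebra) \<Rightarrow> (nat \<Rightarrow> 'x) \<Rightarrow> 'x \<Rightarrow> bool" where
  "cstar_converges d s x \<longleftrightarrow> (\<lambda>n. norm (d (s n) x)) \<longlonglongrightarrow> 0"

definition cstar_Cauchy :: "('x \<Rightarrow> 'x \<Rightarrow> 'a::cstar_algebra) \<Rightarrow> (nat \<Rightarrow> 'x) \<Rightarrow> bool" where
  "cstar_Cauchy d s \<longleftrightarrow>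
    uniform_limit UNIV (\<lambda>n p. norm (d (s (n + p)) (s n))) (\<lambda>_. 0) sequentially"

definition cstar_complete :: "('x \<Rightarrow> 'x \<Rightarrow> 'a::cstar_algebra) \<Rightarrow> 'x set \<Rightarrow> bool" where
  "cstar_complete d S \<longleftrightarrow>
    (\<forall>s. (\<forall>n. s n \<in> S) \<and> cstar_Cauchy d s \<longrightarrow> (\<exists>x\<in>S. cstar_converges d s x))"

definition coupled_coincidence_point ::
    "'x set \<Rightarrow> ('x \<times> 'x \<Rightarrow> 'x) \<Rightarrow> ('x \<Rightarrow> 'x) \<Rightarrow> 'x \<times> 'x \<Rightarrow> bool" where
  "coupled_coincidence_point X F g = (\<lambda>(x, y).
    x \<in> X \<and> y \<in> X \<and> F (x, y) = g x \<and> F (y, x) = g y)"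

definition common_coupled_fixed_point ::
    "'x set \<Rightarrow> ('x \<times> 'x \<Rightarrow> 'x) \<Rightarrow> ('x \<Rightarrow> 'x) \<Rightarrow> 'x \<times> 'x \<Rightarrow> bool" where
  "common_coupled_fixed_point X F g = (\<lambda>(x, y).
    x \<in> X \<and> y \<in> X \<and> F (x, y) = g x \<and> g x = x \<and> F (y, x) = g y \<and> g y = y)"

definition w_compatible ::
    "'x set \<Rightarrow> ('x \<times> 'x \<Rightarrow> 'x) \<Rightarrow> ('x \<Rightarrow> 'x) \<Rightarrow> bool" where
  "w_compatible X F g \<longleftrightarrow> (\<forall>x\<in>X. \<forall>y\<in>X.
    g x = F (x, y) \<and> g y = F (y, x) \<longrightarrow> g (F (x, y)) = F (g x, g y))"

end

theory Submission
  imports Defs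
begin

text \<open>
  Passing to norms turns the statement into one about the real-valued metric \<open>norm (d x y)\<close>: the
  only fact about the order that is needed is \<open>norm x \<le> norm y\<close> for \<open>0 \<preceq> x \<preceq> y\<close>.
  The contraction condition then controls the iteration \<open>g x\<^sub>n\<^sub>+\<^sub>1 = F (x\<^sub>n, x\<^sub>n)\<close> on the diagonal,
  since the second coordinates do not occur on its right-hand side; it is a contraction because one
  of the norms of \<open>a\<close>, \<open>b\<close> is below \<open>1/2\<close>.

  Monotonicity of the norm follows once every hermitian \<open>h\<close> has a spectral value of modulus
  \<open>norm h\<close>: with \<open>z = y - x\<close> and \<open>r = norm z\<close> this gives \<open>norm (r - z) \<le> r\<close> and
  \<open>norm x + r \<le> norm (x + r) = norm (y + (r - z)) \<le> norm y + r\<close>.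
  The spectral value is found by a variant of Rickart's elementary proof of the spectral radius formula.
  If \<open>norm h = 1\<close> and the unit circle misses the spectrum, then \<open>1 - w h\<close> has inverses that
  are uniformly Lipschitz in \<open>w\<close> over the closed disc. The identity
  \<open>(1 - A\<^sup>2)\<^sup>-\<^sup>1 = ((1 - A)\<^sup>-\<^sup>1 + (1 + A)\<^sup>-\<^sup>1) / 2\<close> transports the estimate to \<open>h ^ n\<close> for
  \<open>n = 2 ^ m\<close>, so \<open>(1 - h ^ n)\<^sup>-\<^sup>1\<close> stays close to \<open>(1 - s ^ n h ^ n)\<^sup>-\<^sup>1\<close>, which tends
  to \<open>1\<close> for \<open>s < 1\<close>. This contradicts \<open>norm (h ^ n) = 1\<close>.
\<close>

section \<open>Inverses in Banach algebras\<close>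

definition inverses :: "'a::monoid_mult \<Rightarrow> 'a \<Rightarrow> bool" where
  "inverses x y \<longleftrightarrow> x * y = 1 \<and> y * x = 1"

lemma inverses_mult:
  assumes "inverses x x'" "inverses y y'"
  shows "inverses (x * y) (y' * x')"
proof -
  have "x * y * (y' * x') = x * (y * y') * x'" "y' * x' * (x * y) = y' * (x' * x) * y"
    by (simp_all add: mult.assoc)
  then show ?thesis using assms by (simp add: inverses_def)
qed

text \<open>The inverse is the Neumann series, dominated in norm by the geometric series of
  \<open>norm x\<close>.\<close>

lemma inverses_one_minus:
  fixes x :: "'a::{real_normed_algebra_1,banach}"
  assumes "norm x < 1"
  shows "\<exists>y. inverses (1 - x) y \<and> norm y \<le> 1 / (1 - norm x)"
proof -
  let ?y = "\<Sum>n. x ^ n"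
  have s: "summable (\<lambda>n. x ^ n)"
    by (rule complete_algebra_summable_geometric[OF assms])
  have split: "?y = 1 + (\<Sum>n. x ^ Suc n)"
    using suminf_split_head[OF s] by simp
  have "x * ?y = (\<Sum>n. x ^ Suc n)"
    using suminf_mult[OF s, of x] by simp
  moreover have "?y * x = (\<Sum>n. x ^ Suc n)"
    using suminf_mult2[OF s, of x] by (simp add: power_commutes)
  ultimately have i: "inverses (1 - x) ?y"
    using split by (simp add: inverses_def algebra_simps)
  have "norm ?y \<le> (\<Sum>n. norm x ^ n)"
    using assms by (intro norm_suminf_le) (auto simp: norm_power_ineq summable_geometric)
  also have "\<dots> = 1 / (1 - norm x)"
    using assms by (simp add: suminf_geometric)
  finally show ?thesis using i by blast
qed

text \<open>Writing \<open>u' = u * (1 - v * (u - u'))\<close> reduces this to the Neumann series,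
  whose sum has norm at most 2 under the hypothesis.\<close>

lemma inverses_perturb:
  fixes u :: "'a::{real_normed_algebra_1,banach}"
  assumes "inverses u v" "norm v * norm (u - u') \<le> 1 / 2"
  shows "\<exists>v'. inverses u' v' \<and> norm v' \<le> 2 * norm v"
proof -
  let ?x = "v * (u - u')"
  have x: "norm ?x \<le> 1 / 2"
    using norm_mult_ineq assms(2) by (rule order_trans)
  then obtain y where y: "inverses (1 - ?x) y" "norm y \<le> 1 / (1 - norm ?x)"
    using inverses_one_minus[of ?x] by auto
  have "u * (1 - ?x) = u - u * v * (u - u')"
    by (simp add: algebra_simps)
  then have "u * (1 - ?x) = u'"
    using assms(1) by (simp add: inverses_def)
  then have "inverses u' (y * v)"
    using inverses_mult[OF assms(1) y(1)] by simp
  moreover have "norm y \<le> 2"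
    using y(2) x by (rule_tac order_trans[OF y(2)]) (simp add: field_simps)
  then have "norm (y * v) \<le> 2 * norm v"
    by (meson mult_right_mono norm_ge_zero norm_mult_ineq order_trans)
  ultimately show ?thesis by blast
qed

text \<open>Perturbation bounds the inverses on a ball around each point; finitely many such balls
  cover \<open>S\<close>.\<close>

lemma bounded_inverses_compact:
  fixes f :: "'b::metric_space \<Rightarrow> 'a::{real_normed_algebra_1,banach}"
  assumes S: "compact S" and f: "continuous_on S f"
    and inv: "\<And>w. w \<in> S \<Longrightarrow> \<exists>v. inverses (f w) v"
  shows "\<exists>M>0. \<forall>w\<in>S. \<exists>v. inverses (f w) v \<and> norm v \<le> M"
proof -
  have "\<exists>e>0. \<exists>M. \<forall>w'\<in>S \<inter> ball w e. \<exists>v. inverses (f w') v \<and> norm v \<le> M" if w: "w \<in> S" for w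
  proof -
    obtain v where v: "inverses (f w) v" using inv[OF w] by blast
    have p: "1 / (2 * (norm v + 1)) > 0" by (simp add: add_nonneg_pos)
    obtain e where e: "e > 0" "\<And>w'. w' \<in> S \<Longrightarrow> dist w' w < e \<Longrightarrow> dist (f w') (f w) < 1 / (2 * (norm v + 1))"
      using f w p unfolding continuous_on_iff by meson
    have "\<exists>v'. inverses (f w') v' \<and> norm v' \<le> 2 * norm v" if "w' \<in> S \<inter> ball w e" for w'
    proof (rule inverses_perturb[OF v])
      have "norm (f w - f w') \<le> 1 / (2 * (norm v + 1))"
        using e(2)[of w'] that by (auto simp: dist_norm norm_minus_commute dist_commute)
      then have "norm v * norm (f w - f w') \<le> norm v * (1 / (2 * (norm v + 1)))"
        by (intro mult_left_mono) auto
      also have "\<dots> \<le> 1 / 2"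
        using p by (simp add: divide_le_eq zero_less_divide_iff)
      finally show "norm v * norm (f w - f w') \<le> 1 / 2" .
    qed
    then show ?thesis using e(1) by blast
  qed
  then obtain e M where eM: "\<And>w. w \<in> S \<Longrightarrow> e w > 0"
    "\<And>w w'. w \<in> S \<Longrightarrow> w' \<in> S \<inter> ball w (e w) \<Longrightarrow> \<exists>v. inverses (f w') v \<and> norm v \<le> (M w :: real)"
    by metis
  obtain T where T: "T \<subseteq> S" "finite T" "S \<subseteq> (\<Union>w\<in>T. ball w (e w))"
  proof (rule compactE_image[OF S, of S "\<lambda>w. ball w (e w)"])
    show "S \<subseteq> (\<Union>w\<in>S. ball w (e w))" using eM(1) by force
  qed auto
  show ?thesis
  proof (intro exI[of _ "Max (insert 1 (M ` T))"] conjI ballI)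
    show "Max (insert 1 (M ` T)) > 0"
      using T(2) by (simp add: less_max_iff_disj Max_gr_iff)
    fix w assume w: "w \<in> S"
    then obtain t where t: "t \<in> T" "w \<in> ball t (e t)" using T by blast
    then obtain v where "inverses (f w) v" "norm v \<le> M t"
      using eM(2)[of t w] w T(1) by blast
    moreover have "M t \<le> Max (insert 1 (M ` T))" using T(2) t by simp
    ultimately show "\<exists>v. inverses (f w) v \<and> norm v \<le> Max (insert 1 (M ` T))"
      by (meson order_trans)
  qed
qed

lemma inverses_one_minus_square:
  fixes A :: "'a::real_algebra_1"
  assumes "inverses (1 - A) v1" "inverses (1 + A) v2"
  shows "inverses (1 - A * A) ((1 / 2) *\<^sub>R (v1 + v2))"
proof -
  \<comment> \<open>Both orders of the factors are kept, so that the one to be cancelled can stand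
    next to its inverse on either side.\<close>
  have 1: "1 - A * A = (1 + A) * (1 - A)" and 2: "1 - A * A = (1 - A) * (1 + A)"
    by (simp_all add: algebra_simps)
  have h: "(1 - A) * v1 = 1" "v1 * (1 - A) = 1" "(1 + A) * v2 = 1" "v2 * (1 + A) = 1"
    using assms by (auto simp: inverses_def)
  have "(1 - A * A) * v1 = 1 + A"
    unfolding 1 by (simp add: mult.assoc h)
  moreover have "(1 - A * A) * v2 = 1 - A"
    unfolding 2 by (simp add: mult.assoc h)
  moreover have "v1 * (1 - A * A) = 1 + A"
    unfolding 2 by (simp add: mult.assoc[symmetric] h)
  moreover have "v2 * (1 - A * A) = 1 - A"
    unfolding 1 by (simp add: mult.assoc[symmetric] h)
  ultimately show ?thesis
    unfolding inverses_def
    by (simp add: distrib_left distrib_right scaleR_2[symmetric] del: scaleR_2)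
qed

section \<open>Spectral values of hermitian elements\<close>

lemma scaleC_0_left [simp]: "scaleC 0 x = (0::'a::cstar_algebra)"
  using norm_scaleC[of 0 x] by simp

lemma scaleC_1_left [simp]: "scaleC 1 x = (x::'a::cstar_algebra)"
  using scaleR_scaleC[of 1 x] by simp

lemma scaleC_minus_left: "scaleC (- c) x = - scaleC c (x::'a::cstar_algebra)"
  using scaleC_add_left[of c "- c" x] by (simp add: minus_unique)

lemma scaleC_diff_left: "scaleC (c - c') x = scaleC c x - scaleC c' (x::'a::cstar_algebra)"
  using scaleC_add_left[of c "- c'" x] by (simp add: scaleC_minus_left)

lemma scaleC_minus_right: "scaleC c (- x) = - scaleC c (x::'a::cstar_algebra)"
  using scaleC_scaleC[of c "- 1" x] scaleC_minus_left[of 1 x] scaleC_minus_left[of c x] by simp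

lemma scaleC_diff_right: "scaleC c (x - y) = scaleC c x - scaleC c (y::'a::cstar_algebra)"
  using scaleC_add_right[of c x "- y"] by (simp add: scaleC_minus_right)

lemma scaleC_power: "(scaleC c x) ^ n = scaleC (c ^ n) ((x::'a::cstar_algebra) ^ n)"
  by (induction n) (simp_all add: mult_scaleC_left mult_scaleC_right scaleC_scaleC mult.commute)

lemma spectrum_iff: "z \<in> spectrum a \<longleftrightarrow> (\<nexists>b. inverses (a - scaleC z 1) b)"
  by (simp add: spectrum_def inverses_def)

lemma inverses_scaleC:
  fixes x :: "'a::cstar_algebra"
  assumes "inverses x y" "c \<noteq> 0"
  shows "inverses (scaleC c x) (scaleC (inverse c) y)"
  using assms by (simp add: inverses_def mult_scaleC_left mult_scaleC_right scaleC_scaleC)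

text \<open>For larger \<open>z\<close> the factor \<open>1 - a / z\<close> of \<open>a - z\<close>
  is invertible by the Neumann series.\<close>

lemma spectrum_norm_le:
  fixes a :: "'a::cstar_algebra"
  assumes "z \<in> spectrum a"
  shows "cmod z \<le> norm a"
proof (rule ccontr)
  assume "\<not> cmod z \<le> norm a"
  then have z: "cmod z > norm a" by simp
  then have z0: "z \<noteq> 0" by auto
  have "norm (scaleC (inverse z) a) < 1"
    using z z0 by (simp add: norm_scaleC norm_inverse norm_divide divide_simps)
  then obtain y where "inverses (1 - scaleC (inverse z) a) y"
    using inverses_one_minus by blast
  from inverses_scaleC[OF this, of "- z"] z0
  have "inverses (scaleC (- z) (1 - scaleC (inverse z) a)) (scaleC (inverse (- z)) y)" by simp
  moreover have "scaleC (- z) (1 - scaleC (inverse z) a) = a - scaleC z 1"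
    using z0 by (simp add: scaleC_diff_right scaleC_scaleC scaleC_minus_left)
  ultimately show False using assms by (auto simp: spectrum_iff)
qed

lemma spectrum_shift:
  fixes a :: "'a::cstar_algebra"
  assumes "z \<in> spectrum a"
  shows "z + of_real r \<in> spectrum (a + r *\<^sub>R 1)"
proof -
  have "a + r *\<^sub>R 1 - scaleC (z + of_real r) 1 = a - scaleC z 1"
    by (simp add: scaleR_scaleC scaleC_add_left)
  then show ?thesis using assms by (simp only: spectrum_iff) simp
qed

lemma spectrum_uminus:
  fixes a :: "'a::cstar_algebra"
  assumes "z \<in> spectrum a"
  shows "- z \<in> spectrum (- a)"
proof -
  have e: "- a - scaleC (- z) 1 = - (a - scaleC z 1)"
    by (simp add: scaleC_minus_left)
  have "inverses (a - scaleC z 1) (- b)" if "inverses (- a - scaleC (- z) 1) b" for b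
    using that unfolding e inverses_def by (simp only: mult_minus_left mult_minus_right)
  then show ?thesis using assms by (auto simp: spectrum_iff)
qed

lemma hermitian_one: "hermitian (1::'a::cstar_algebra)"
  using adj_mult[of "adj (1::'a)" 1] by (simp add: hermitian_def adj_adj)

lemma hermitian_scaleR: "hermitian a \<Longrightarrow> hermitian (r *\<^sub>R (a::'a::cstar_algebra))"
  by (simp add: hermitian_def scaleR_scaleC adj_scaleC)

lemma hermitian_diff: "hermitian a \<Longrightarrow> hermitian b \<Longrightarrow> hermitian (a - b::'a::cstar_algebra)"
  using adj_add[of a "scaleC (- 1) b"]
  by (simp add: hermitian_def adj_scaleC) (simp add: scaleC_minus_left)

lemma hermitian_power: "hermitian a \<Longrightarrow> hermitian ((a::'a::cstar_algebra) ^ n)"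
  by (induction n) (auto simp: hermitian_one[unfolded hermitian_def] hermitian_def adj_mult power_commutes)

text \<open>For hermitian elements the C*-identity says that squaring the element squares the norm;
  iterate.\<close>

lemma norm_hermitian_power:
  fixes h :: "'a::cstar_algebra"
  assumes "hermitian h"
  shows "norm (h ^ 2 ^ m) = norm h ^ 2 ^ m"
proof (induction m)
  case (Suc m)
  have "h ^ 2 ^ Suc m = adj (h ^ 2 ^ m) * h ^ 2 ^ m"
    using hermitian_power[OF assms] by (simp add: hermitian_def mult_2 power_add)
  then show ?case
    by (simp add: cstar_identity Suc power2_eq_square mult_2 power_add)
qed simp

text \<open>For \<open>n = 2 ^ m\<close> a root \<open>\<omega>\<close> of \<open>\<omega> ^ n = - 1\<close> turns \<open>1 - A\<close> into \<open>1 + A\<close>, so averaging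
  the estimates at \<open>w\<close> and \<open>w \<omega>\<close> loses nothing.\<close>

lemma resolvent_estimate_power:
  fixes h :: "'a::cstar_algebra"
  assumes base: "\<And>w. cmod w = 1 \<Longrightarrow> \<exists>v v'. inverses (1 - scaleC w h) v \<and>
      inverses (1 - scaleC (of_real s * w) h) v' \<and> norm (v - v') \<le> e"
    and w: "cmod w = 1"
  shows "\<exists>v v'. inverses (1 - scaleC w h ^ 2 ^ m) v \<and>
      inverses (1 - scaleC (of_real s * w) h ^ 2 ^ m) v' \<and> norm (v - v') \<le> e"
  using w
proof (induction m arbitrary: w)
  case 0
  then show ?case using base by simp
next
  case (Suc m)
  let ?A = "scaleC w h ^ 2 ^ m" and ?B = "scaleC (of_real s * w) h ^ 2 ^ m"
  define \<omega> where "\<omega> = cis (pi / 2 ^ m)"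
  have \<omega>: "\<omega> ^ 2 ^ m = - 1"
    by (simp add: \<omega>_def Complex.DeMoivre)
  have neg: "scaleC (c * (w * \<omega>)) h ^ 2 ^ m = - (scaleC (c * w) h ^ 2 ^ m)" for c
    by (simp add: scaleC_power power_mult_distrib \<omega> scaleC_minus_left)
  obtain v1 v1' where 1: "inverses (1 - ?A) v1" "inverses (1 - ?B) v1'" "norm (v1 - v1') \<le> e"
    using Suc.IH[OF Suc.prems] by blast
  have "cmod (w * \<omega>) = 1"
    using Suc.prems by (simp add: norm_mult \<omega>_def)
  from Suc.IH[OF this] neg[of 1] neg[of "of_real s"]
  obtain v2 v2' where 2: "inverses (1 + ?A) v2" "inverses (1 + ?B) v2'" "norm (v2 - v2') \<le> e"
    by auto
  let ?v = "(1 / 2) *\<^sub>R (v1 + v2)" and ?v' = "(1 / 2) *\<^sub>R (v1' + v2')"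
  have "?v - ?v' = (1 / 2) *\<^sub>R ((v1 - v1') + (v2 - v2'))"
    by (simp add: algebra_simps)
  then have "norm (?v - ?v') = norm ((v1 - v1') + (v2 - v2')) / 2"
    by simp
  also have "\<dots> \<le> e"
    using norm_triangle_ineq[of "v1 - v1'" "v2 - v2'"] 1(3) 2(3) by linarith
  finally have "norm (?v - ?v') \<le> e" .
  moreover have "scaleC c h ^ 2 ^ Suc m = scaleC c h ^ 2 ^ m * scaleC c h ^ 2 ^ m" for c
    by (simp add: mult_2 power_add)
  ultimately show ?case
    using inverses_one_minus_square[OF 1(1) 2(1)] inverses_one_minus_square[OF 1(2) 2(2)]
    by metis
qed

lemma unit_circle_meets_spectrum:
  fixes h :: "'a::cstar_algebra"
  assumes h: "hermitian h" and n1: "norm h = 1"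
  shows "\<exists>w. cmod w = 1 \<and> (\<nexists>v. inverses (1 - scaleC w h) v)"
proof (rule ccontr)
  assume "\<not> ?thesis"
  then have circ: "\<exists>v. inverses (1 - scaleC w h) v" if "cmod w = 1" for w
    using that by blast
  have inv: "\<exists>v. inverses (1 - scaleC w h) v" if "w \<in> cball 0 1" for w
  proof (cases "cmod w = 1")
    case False
    then have "norm (scaleC w h) < 1" using that n1 by (simp add: norm_scaleC)
    then show ?thesis using inverses_one_minus by blast
  qed (rule circ)
  have "continuous_on (cball 0 1) (\<lambda>w. 1 - scaleC w h)"
    unfolding continuous_on_iff
    by (auto simp: dist_norm scaleC_diff_left[symmetric] norm_scaleC n1 norm_minus_commute)
  from bounded_inverses_compact[OF compact_cball this inv]
  obtain M where M: "M > 0" "\<And>w. cmod w \<le> 1 \<Longrightarrow> \<exists>v. inverses (1 - scaleC w h) v \<and> norm v \<le> M"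
    by auto
  \<comment> \<open>The bound by \<open>1 / (8 * M * M)\<close> makes the resolvent difference below
    at most \<open>1 / 8\<close>; the bound by \<open>1 / 2\<close> keeps \<open>s\<close>
    positive.\<close>
  define \<delta> where "\<delta> = min (1 / 2) (1 / (8 * M * M))"
  define s where "s = 1 - \<delta>"
  have \<delta>: "0 < \<delta>" "\<delta> \<le> 1 / 2" "\<delta> \<le> 1 / (8 * M * M)"
    using M(1) by (auto simp: \<delta>_def)
  have s: "0 < s" "s < 1" using \<delta> by (auto simp: s_def)
  have M\<delta>: "M * \<delta> * M \<le> 1 / 8"
    using \<delta>(3) M(1) by (simp add: field_simps)
  have "\<exists>v v'. inverses (1 - scaleC w h) v \<and> inverses (1 - scaleC (of_real s * w) h) v' \<and>
      norm (v - v') \<le> 1 / 8" if w: "cmod w = 1" for w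
  proof -
    have "cmod (of_real s * w) \<le> 1" using s w by (simp add: norm_mult)
    then obtain v v' where v: "inverses (1 - scaleC w h) v" "norm v \<le> M"
      and v': "inverses (1 - scaleC (of_real s * w) h) v'" "norm v' \<le> M"
      using M(2) w by (metis order_refl)
    let ?u = "1 - scaleC w h" and ?u' = "1 - scaleC (of_real s * w) h"
    \<comment> \<open>This is the resolvent identity.\<close>
    have "v - v' = v * (?u' - ?u) * v'"
    proof -
      have "v * (?u' - ?u) * v' = v * (?u' * v') - (v * ?u) * v'"
        by (simp only: left_diff_distrib right_diff_distrib mult.assoc)
      then show ?thesis using v(1) v'(1) by (simp only: inverses_def) simp
    qed
    then have "norm (v - v') \<le> norm (v * (?u' - ?u)) * norm v'"
      by (simp only: norm_mult_ineq)
    also have "\<dots> \<le> norm v * norm (?u' - ?u) * norm v'"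
      by (rule mult_right_mono[OF norm_mult_ineq norm_ge_zero])
    also have "?u' - ?u = scaleC (of_real \<delta> * w) h"
      by (simp add: s_def scaleC_diff_left left_diff_distrib)
    then have "norm (?u' - ?u) = \<delta>"
      using \<delta> w n1 by (simp add: norm_scaleC norm_mult)
    also have "norm v * \<delta> * norm v' \<le> M * \<delta> * M"
      using v(2) v'(2) \<delta> M(1) by (intro mult_mono) auto
    finally show ?thesis using v(1) v'(1) M\<delta> by fastforce
  qed
  note est = resolvent_estimate_power[OF this, of 1, simplified]
  obtain k where k: "s ^ k < 1 / 4"
    using real_arch_pow_inv[of "1 / 4" s] s by auto
  \<comment> \<open>The transported estimate needs a power of two as exponent;
    \<open>k \<le> 2 ^ k\<close> keeps \<open>s ^ n\<close> small.\<close>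
  define n :: nat where "n = 2 ^ k"
  have "s ^ n \<le> s ^ k"
    using s by (intro power_decreasing) (auto simp: n_def less_imp_le)
  with k have sn: "s ^ n < 1 / 4" by simp
  have hn: "norm (h ^ n) = 1"
    using norm_hermitian_power[OF h] n1 by (simp add: n_def)
  obtain v v' where v: "inverses (1 - h ^ n) v" and v': "inverses (1 - scaleC (of_real s) h ^ n) v'"
    and vv': "norm (v - v') \<le> 1 / 8"
    using est[of k] unfolding n_def by auto
  define A where "A = scaleC (of_real s) h ^ n"
  have A: "norm A < 1 / 4"
    using sn s hn by (simp add: A_def scaleC_power norm_scaleC norm_power)
  \<comment> \<open>Since \<open>norm A < 1 / 4\<close>, solving this relation for the norm gives
    \<open>1 / 3\<close>, and \<open>1 / 3 + 1 / 8 < 1 / 2\<close>.\<close>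
  have "v' - 1 = A + A * (v' - 1)"
    using v' unfolding A_def[symmetric] by (simp add: inverses_def algebra_simps)
  then have "norm (v' - 1) \<le> norm A + norm A * norm (v' - 1)"
    by (metis norm_mult_ineq norm_triangle_ineq add_left_mono order_trans)
  also have "\<dots> \<le> 1 / 4 + 1 / 4 * norm (v' - 1)"
    using A by (intro add_mono mult_right_mono) auto
  finally have "norm (v' - 1) \<le> 1 / 3" by simp
  then have v1: "norm (v - 1) < 1 / 2"
    using vv' norm_triangle_ineq[of "v - v'" "v' - 1"] by simp
  \<comment> \<open>The second factor has norm at most 2, so \<open>h ^ n\<close> would have norm
    below 1.\<close>
  have "h ^ n = (v - 1) * (1 - h ^ n)"
    using v by (simp add: inverses_def algebra_simps)
  then have "norm (h ^ n) \<le> norm (v - 1) * norm (1 - h ^ n)"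
    by (metis norm_mult_ineq)
  also have "\<dots> \<le> norm (v - 1) * 2"
    using norm_triangle_ineq4[of 1 "h ^ n"] hn by (intro mult_left_mono) auto
  finally show False using hn v1 by simp
qed

lemma hermitian_spectral_radius:
  fixes h :: "'a::cstar_algebra"
  assumes h: "hermitian h"
  shows "\<exists>z\<in>spectrum h. cmod z = norm h"
proof (cases "h = 0")
  case True
  then have "0 \<in> spectrum h" by (simp add: spectrum_def)
  then show ?thesis using True by force
next
  case False
  define r where "r = norm h"
  have r: "r > 0" using False by (simp add: r_def)
  have "norm ((1 / r) *\<^sub>R h) = 1" using r by (simp add: r_def)
  then obtain w where w: "cmod w = 1" "\<nexists>v. inverses (1 - scaleC w ((1 / r) *\<^sub>R h)) v"
    using unit_circle_meets_spectrum[OF hermitian_scaleR[OF h]] by blast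
  have w0: "w \<noteq> 0" using w(1) by auto
  \<comment> \<open>With this \<open>z\<close>, the element \<open>h - z\<close> is a nonzero
    multiple of \<open>1 - w h / r\<close>.\<close>
  let ?z = "of_real r / w"
  have "?z \<in> spectrum h"
    unfolding spectrum_iff
  proof
    assume "\<exists>b. inverses (h - scaleC ?z 1) b"
    then obtain b where "inverses (h - scaleC ?z 1) b" by blast
    from inverses_scaleC[OF this, of "- w / of_real r"] w0 r
    have "\<exists>v. inverses (scaleC (- w / of_real r) (h - scaleC ?z 1)) v" by auto
    moreover have "scaleC (- w / of_real r) (h - scaleC ?z 1) = 1 - scaleC w ((1 / r) *\<^sub>R h)"
      using w0 r by (simp add: scaleC_diff_right scaleC_scaleC scaleR_scaleC scaleC_minus_left)
    ultimately show False using w(2) by simp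
  qed
  moreover have "cmod ?z = norm h"
    using w(1) r by (simp add: norm_divide r_def)
  ultimately show ?thesis by blast
qed

section \<open>Monotonicity of the norm\<close>

text \<open>By positivity \<open>norm x\<close> itself is a spectral value, and the shift moves it
  to \<open>norm x + r\<close>.\<close>

lemma norm_positive_add_scaleR:
  fixes x :: "'a::cstar_algebra"
  assumes "positive x" "r \<ge> 0"
  shows "norm x + r \<le> norm (x + r *\<^sub>R 1)"
proof -
  obtain z where z: "z \<in> spectrum x" "cmod z = norm x"
    using hermitian_spectral_radius assms(1) by (auto simp: positive_def)
  then obtain t where t: "z = of_real t" "t \<ge> 0"
    using assms(1) by (auto simp: positive_def)
  have "cmod (z + of_real r) \<le> norm (x + r *\<^sub>R 1)"
    using spectrum_norm_le[OF spectrum_shift[OF z(1)]] .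
  moreover have "cmod (z + of_real r) = t + r"
    using t(2) assms(2) unfolding t(1) of_real_add[symmetric] norm_of_real by simp
  moreover have "norm x = t" using z(2) t by simp
  ultimately show ?thesis by simp
qed

text \<open>Spectral values of the difference are \<open>norm z - t\<close> with \<open>t\<close> in
  the spectrum of \<open>z\<close>, hence \<open>0 \<le> t \<le> norm z\<close>.\<close>

lemma norm_scaleR_minus_positive:
  fixes z :: "'a::cstar_algebra"
  assumes "positive z"
  shows "norm (norm z *\<^sub>R 1 - z) \<le> norm z"
proof -
  let ?r = "norm z"
  have "hermitian (?r *\<^sub>R 1 - z)"
    using assms by (simp add: positive_def hermitian_diff hermitian_scaleR hermitian_one)
  then obtain c where c: "c \<in> spectrum (?r *\<^sub>R 1 - z)" "cmod c = norm (?r *\<^sub>R 1 - z)"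
    using hermitian_spectral_radius by blast
  have "- c + of_real ?r \<in> spectrum (- (?r *\<^sub>R 1 - z) + ?r *\<^sub>R 1)"
    by (rule spectrum_shift[OF spectrum_uminus[OF c(1)]])
  then have m: "of_real ?r - c \<in> spectrum z" by simp
  then obtain t where t: "of_real ?r - c = of_real t" "t \<ge> 0"
    using assms by (auto simp: positive_def)
  have "t \<le> ?r"
    using spectrum_norm_le[OF m] t by simp
  moreover have "c = of_real (?r - t)"
    using t(1) by (simp add: algebra_simps)
  ultimately show ?thesis
    using c(2) t(2) by (simp del: of_real_diff)
qed

lemma norm_mono_positive:
  fixes x y :: "'a::cstar_algebra"
  assumes "positive x" "positive (y - x)"
  shows "norm x \<le> norm y"
proof -
  let ?r = "norm (y - x)"
  have "norm x + ?r \<le> norm (x + ?r *\<^sub>R 1)"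
    using assms(1) by (rule norm_positive_add_scaleR) simp
  also have "x + ?r *\<^sub>R 1 = y + (?r *\<^sub>R 1 - (y - x))" by simp
  also have "norm \<dots> \<le> norm y + ?r"
    using norm_triangle_ineq norm_scaleR_minus_positive[OF assms(2)] by (meson add_left_mono order_trans)
  finally show ?thesis by simp
qed

lemma norm_mono_cstar_le: "0 \<preceq> x \<Longrightarrow> x \<preceq> y \<Longrightarrow> norm x \<le> norm y"
  by (rule norm_mono_positive) (simp_all add: cstar_le_def)

section \<open>Coupled coincidence points\<close>

context cstar_metric_space
begin

lemma norm_dist_triangle:
  assumes "x \<in> X" "y \<in> X" "z \<in> X"
  shows "norm (d x y) \<le> norm (d x z) + norm (d z y)"
  using norm_mono_cstar_le[OF dist_pos dist_triangle] assms norm_triangle_ineq order_trans by blast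

lemma norm_dist_eq_0_iff: "x \<in> X \<Longrightarrow> y \<in> X \<Longrightarrow> norm (d x y) = 0 \<longleftrightarrow> x = y"
  by (simp add: dist_eq_0_iff)

lemma geometric_Cauchy:
  assumes sX: "\<And>n. s n \<in> X" and h: "0 \<le> h" "h < 1"
    and step: "\<And>n. norm (d (s (Suc (Suc n))) (s (Suc n))) \<le> h * norm (d (s (Suc n)) (s n))"
  shows "cstar_Cauchy d s"
proof -
  define C where "C = norm (d (s 1) (s 0))"
  have 1: "norm (d (s (Suc n)) (s n)) \<le> C * h ^ n" for n
  proof (induction n)
    case (Suc n)
    show ?case
      using step[of n] mult_left_mono[OF Suc h(1)] by (simp add: mult_ac)
  qed (simp add: C_def)
  have 2: "norm (d (s (n + p)) (s n)) \<le> C * h ^ n * (\<Sum>i<p. h ^ i)" for n p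
  proof (induction p)
    case 0
    show ?case using dist_eq_0_iff sX by simp
  next
    case (Suc p)
    have "norm (d (s (n + Suc p)) (s n)) \<le> norm (d (s (Suc (n + p))) (s (n + p))) + norm (d (s (n + p)) (s n))"
      using norm_dist_triangle sX by simp
    also have "\<dots> \<le> C * h ^ (n + p) + C * h ^ n * (\<Sum>i<p. h ^ i)"
      using 1 Suc by (rule add_mono)
    finally show ?case by (simp add: algebra_simps power_add)
  qed
  have C: "C \<ge> 0" by (simp add: C_def)
  \<comment> \<open>The bound is free of \<open>p\<close>, which gives the uniformity in the Cauchy
    condition.\<close>
  have 3: "norm (d (s (n + p)) (s n)) \<le> C / (1 - h) * h ^ n" for n p
  proof -
    have "(\<Sum>i<p. h ^ i) \<le> (\<Sum>i. h ^ i)"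
      using h by (intro sum_le_suminf) auto
    then have "C * h ^ n * (\<Sum>i<p. h ^ i) \<le> C * h ^ n * (1 / (1 - h))"
      using h C by (intro mult_left_mono) (auto simp: suminf_geometric)
    then show ?thesis using 2[of n p] by (simp add: field_simps)
  qed
  have lim: "(\<lambda>n. C / (1 - h) * h ^ n) \<longlonglongrightarrow> 0"
    using LIMSEQ_power_zero[of h] h by (intro tendsto_mult_right_zero) auto
  show ?thesis
    unfolding cstar_Cauchy_def uniform_limit_iff
  proof (intro allI impI)
    fix e :: real assume "e > 0"
    with lim have "\<forall>\<^sub>F n in sequentially. C / (1 - h) * h ^ n < e"
      by (rule order_tendstoD)
    then show "\<forall>\<^sub>F n in sequentially. \<forall>p\<in>UNIV. dist (norm (d (s (n + p)) (s n))) 0 < e"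
    proof eventually_elim
      case (elim n)
      then show ?case using le_less_trans[OF 3[of n]] by auto
    qed
  qed
qed

text \<open>Swapping the two arguments of \<open>d\<close> exchanges \<open>\<alpha>\<close> and \<open>\<beta>\<close>, so the smaller of the two controls
  the ratio of successive distances.\<close>

lemma exists_coincidence_point:
  assumes F: "\<And>x. x \<in> X \<Longrightarrow> f x \<in> g ` X" and g: "g \<in> X \<rightarrow> X"
    and ab: "0 \<le> \<alpha>" "0 \<le> \<beta>" "\<alpha> + \<beta> < 1"
    and contr: "\<And>x u. \<lbrakk>x \<in> X; u \<in> X\<rbrakk> \<Longrightarrow>
      norm (d (f x) (f u)) \<le> \<alpha> * norm (d (f x) (g u)) + \<beta> * norm (d (f u) (g x))"
    and compl: "cstar_complete d (g ` X)"
  shows "\<exists>x\<in>X. f x = g x"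
proof -
  have gX: "g x \<in> X" if "x \<in> X" for x using g that by auto
  have fX: "f x \<in> X" if "x \<in> X" for x using F[OF that] gX by auto
  have "\<forall>x\<in>X. \<exists>y. y \<in> X \<and> g y = f x" using F by force
  then obtain \<phi> where \<phi>: "\<And>x. x \<in> X \<Longrightarrow> \<phi> x \<in> X \<and> g (\<phi> x) = f x"
    by (auto dest!: bchoice)
  obtain x0 where x0: "x0 \<in> X" using nonempty by blast
  define x where "x n = (\<phi> ^^ n) x0" for n
  have xX: "x n \<in> X" for n
    by (induction n) (auto simp: x_def x0 \<phi>)
  have gx: "g (x (Suc n)) = f (x n)" for n
    using \<phi>[OF xX[of n]] by (simp add: x_def)
  define s where "s n = g (x n)" for n
  have sX: "s n \<in> X" for n using gX xX by (simp add: s_def)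
  have s: "s (Suc n) = f (x n)" for n by (simp add: s_def gx)
  \<comment> \<open>As \<open>\<alpha> + \<beta> < 1\<close>, the minimum is below
    \<open>1 / 2\<close>, so \<open>c / (1 - c) < 1\<close>.\<close>
  define c where "c = min \<alpha> \<beta>"
  have c: "0 \<le> c" "c < 1 / 2" using ab by (auto simp: c_def)
  define D where "D n = norm (d (s (Suc n)) (s n))" for n
  have step: "D (Suc n) \<le> c / (1 - c) * D n" for n
  proof -
    let ?E = "norm (d (s (Suc (Suc n))) (s n))"
    \<comment> \<open>In either order of the arguments one term of the contraction compares
      \<open>f (x n)\<close> with \<open>g (x (Suc n))\<close>, which are equal; only a multiple of
      \<open>?E\<close> remains.\<close>
    have z: "d (s (Suc n)) (s (Suc n)) = 0" using dist_eq_0_iff sX by simp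
    have "D (Suc n) \<le> \<alpha> * ?E"
      using contr[OF xX xX, of "Suc n" n] z unfolding D_def by (simp add: s[symmetric] s_def[symmetric])
    moreover have "D (Suc n) \<le> \<beta> * ?E"
      using contr[OF xX xX, of n "Suc n"] z dist_sym[OF sX sX, of "Suc n" "Suc (Suc n)"] unfolding D_def
      by (simp add: s[symmetric] s_def[symmetric])
    ultimately have "D (Suc n) \<le> c * ?E"
      by (simp add: c_def min_def)
    also have "\<dots> \<le> c * (D (Suc n) + D n)"
      unfolding D_def using norm_dist_triangle[OF sX sX sX] c(1) by (intro mult_left_mono) auto
    finally show ?thesis using c by (simp add: field_simps)
  qed
  have "cstar_Cauchy d s"
  proof (rule geometric_Cauchy[OF sX])
    show "norm (d (s (Suc (Suc n))) (s (Suc n))) \<le> c / (1 - c) * norm (d (s (Suc n)) (s n))" for n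
      using step by (simp add: D_def)
  qed (use c in auto)
  moreover have "s n \<in> g ` X" for n using xX by (simp add: s_def)
  ultimately obtain y where y: "y \<in> X" "cstar_converges d s (g y)"
    using compl unfolding cstar_complete_def by blast
  let ?\<epsilon> = "\<lambda>n. norm (d (s n) (g y))"
  have lim: "?\<epsilon> \<longlonglongrightarrow> 0" using y(2) by (simp add: cstar_converges_def)
  \<comment> \<open>Pass through \<open>s (Suc n) = f (x n)\<close> and contract against
    \<open>f y\<close>; in the limit only the factor \<open>\<beta> < 1\<close> remains.\<close>
  have ineq: "norm (d (f y) (g y)) \<le> \<alpha> * ?\<epsilon> (Suc n) + \<beta> * (norm (d (f y) (g y)) + ?\<epsilon> n) + ?\<epsilon> (Suc n)" for n
  proof -
    have "norm (d (f y) (g y)) \<le> norm (d (s (Suc n)) (f y)) + ?\<epsilon> (Suc n)"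
      using norm_dist_triangle[OF fX[OF y(1)] gX[OF y(1)] sX[of "Suc n"]] dist_sym[OF fX[OF y(1)] sX[of "Suc n"]]
      by simp
    moreover have "norm (d (s (Suc n)) (f y)) \<le> \<alpha> * ?\<epsilon> (Suc n) + \<beta> * norm (d (f y) (s n))"
      using contr[OF xX[of n] y(1)] by (simp add: s_def gx)
    moreover have "norm (d (f y) (s n)) \<le> norm (d (f y) (g y)) + ?\<epsilon> n"
      using norm_dist_triangle[OF fX[OF y(1)] sX[of n] gX[OF y(1)]] dist_sym[OF gX[OF y(1)] sX[of n]] by simp
    then have "\<beta> * norm (d (f y) (s n)) \<le> \<beta> * (norm (d (f y) (g y)) + ?\<epsilon> n)"
      using ab(2) by (rule mult_left_mono)
    ultimately show ?thesis by linarith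
  qed
  have "(\<lambda>n. \<alpha> * ?\<epsilon> (Suc n) + \<beta> * (norm (d (f y) (g y)) + ?\<epsilon> n) + ?\<epsilon> (Suc n))
      \<longlonglongrightarrow> \<alpha> * 0 + \<beta> * (norm (d (f y) (g y)) + 0) + 0"
    using lim LIMSEQ_Suc[OF lim] by (intro tendsto_intros)
  then have "norm (d (f y) (g y)) \<le> \<alpha> * 0 + \<beta> * (norm (d (f y) (g y)) + 0) + 0"
    by (rule LIMSEQ_le_const) (use ineq in blast)
  then have "(1 - \<beta>) * norm (d (f y) (g y)) \<le> 0" by (simp add: algebra_simps)
  moreover have "1 - \<beta> > 0" using ab by simp
  ultimately have "norm (d (f y) (g y)) = 0"
    by (simp add: mult_le_0_iff)
  then show ?thesis
    using norm_dist_eq_0_iff fX gX y(1) by blast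
qed

end

theorem theorem2p3:
  fixes X :: "'x set"
    and d :: "'x \<Rightarrow> 'x \<Rightarrow> 'a::cstar_algebra"
    and F :: "'x \<times> 'x \<Rightarrow> 'x"
    and g :: "'x \<Rightarrow> 'x"
    and a b :: 'a
  assumes "cstar_metric_space X d"
    and "cstar_complete d X"
    and "F \<in> X \<times> X \<rightarrow> X"
    and "g \<in> X \<rightarrow> X"
    and "a \<in> positive_commutant"
    and "b \<in> positive_commutant"
    and "norm a + norm b < 1"
    and "\<And>x y u v. \<lbrakk>x \<in> X; y \<in> X; u \<in> X; v \<in> X\<rbrakk> \<Longrightarrow>
          d (F (x, y)) (F (u, v)) \<preceq> a * d (F (x, y)) (g u) + b * d (F (u, v)) (g x)"
    and "F ` (X \<times> X) \<subseteq> g ` X"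
    and "cstar_complete d (g ` X)"
  shows "(\<exists>p. coupled_coincidence_point X F g p) \<and>
         (w_compatible X F g \<longrightarrow> (\<exists>!p. common_coupled_fixed_point X F g p))"
proof -
  interpret cstar_metric_space X d by fact
  have gX: "g x \<in> X" if "x \<in> X" for x using assms(4) that by auto
  have FX: "F (x, y) \<in> X" if "x \<in> X" "y \<in> X" for x y using assms(3) that by auto
  have contr: "norm (d (F (x, y)) (F (u, v))) \<le>
      norm a * norm (d (F (x, y)) (g u)) + norm b * norm (d (F (u, v)) (g x))"
    if "x \<in> X" "y \<in> X" "u \<in> X" "v \<in> X" for x y u v
  proof -
    have "norm (d (F (x, y)) (F (u, v))) \<le> norm (a * d (F (x, y)) (g u) + b * d (F (u, v)) (g x))"
      using norm_mono_cstar_le[OF dist_pos assms(8)] that FX by blast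
    also have "\<dots> \<le> norm (a * d (F (x, y)) (g u)) + norm (b * d (F (u, v)) (g x))"
      by (rule norm_triangle_ineq)
    also have "\<dots> \<le> norm a * norm (d (F (x, y)) (g u)) + norm b * norm (d (F (u, v)) (g x))"
      by (intro add_mono norm_mult_ineq)
    finally show ?thesis .
  qed
  have "\<exists>x\<in>X. F (x, x) = g x"
    using assms(4,7,9,10) contr
    by (intro exists_coincidence_point[of "\<lambda>x. F (x, x)" g "norm a" "norm b"]) auto
  then obtain x where x: "x \<in> X" "F (x, x) = g x" by blast
  \<comment> \<open>Comparing \<open>(p, q)\<close> with \<open>(x, x)\<close> needs just one of the
    two coincidence equations; the swapped pair treats \<open>q\<close>.\<close>
  have unique: "g p = g x" if p: "p \<in> X" "q \<in> X" "F (p, q) = g p" for p q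
  proof -
    let ?D = "norm (d (g p) (g x))"
    have "?D \<le> norm a * ?D + norm b * ?D"
      using contr[OF p(1,2) x(1,1)] p(3) x(2) dist_sym[OF gX[OF x(1)] gX[OF p(1)]] by simp
    then have "(1 - (norm a + norm b)) * ?D \<le> 0" by (simp add: algebra_simps)
    moreover have "1 - (norm a + norm b) > 0" using assms(7) by simp
    ultimately have "?D = 0"
      by (simp add: mult_le_0_iff)
    then show ?thesis using norm_dist_eq_0_iff gX x(1) p(1) by blast
  qed
  have "coupled_coincidence_point X F g (x, x)"
    using x by (simp add: coupled_coincidence_point_def)
  moreover have "\<exists>!p. common_coupled_fixed_point X F g p" if "w_compatible X F g"
  proof (rule ex1I)
    \<comment> \<open>Compatibility makes \<open>(g x, g x)\<close> another coincidence point, so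
      \<open>unique\<close> forces \<open>g (g x) = g x\<close>.\<close>
    have gg: "g (g x) = F (g x, g x)"
      using that x unfolding w_compatible_def by force
    then have "g (g x) = g x"
      by (intro unique[OF gX gX]) (simp_all add: x(1))
    then show "common_coupled_fixed_point X F g (g x, g x)"
      using gg gX x(1) by (simp add: common_coupled_fixed_point_def)
    \<comment> \<open>Apply \<open>unique\<close> to the pair and to its swap; \<open>g\<close>
      fixes both coordinates.\<close>
    show "p = (g x, g x)" if "common_coupled_fixed_point X F g p" for p
      using that unique by (cases p) (force simp: common_coupled_fixed_point_def)
  qed
  ultimately show ?thesis by blast
qed

end
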